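(* Let $r_1,r_2>0$ be real numbers with $r_1+r_2\neq 1$, let $n\geq0$ be an integer and let $y\neq -1$ be complex. Then \[ \sum_{k=0}^{n}\binom{n}{k}w_{k}^{(r_{1})}(y)\,w_{n-k}^{(r_{2})}(y)=\frac{w_{n+1}^{(r_{1}+r_{2}-1)}(y)+(r_{1}+r_{2}-1)\,w_{n}^{(r_{1}+r_{2}-1)}(y)}{(r_{1}+r_{2}-1)(1+y)}. \]
   Context: For real $r$ and an integer $n\geq 0$, the higher order geometric polynomial $w_{n}^{(r)}(y)$ is defined by $\sum_{n\ge0}w_n^{(r)}(y)\frac{t^n}{n!}=\bigl(1-y(e^t-1)\bigr)^{-r}$; equivalently $w_{n}^{(r)}(y)=\sum_{k=0}^{n}\left\{{n\atop k}\right\}(r)_{k}\,y^{k}$, where $\left\{{n\atop k}\right\}$ are Stirling numbers of the second kind and $(x)_{k}=x(x+1)\cdots(x+k-1)$, $(x)_0=1$. *)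

theory Defs
  imports
    Complex_Main
    "HOL-Computational_Algebra.Formal_Power_Series"
    "HOL-Combinatorics.Stirling"
begin

text \<open>
  The exponential generating function \<open>(1 - y (e\<^sup>t - 1))\<^sup>-\<^sup>r\<close>: the binomial series
  \<open>(1 + X)\<^sup>-\<^sup>r\<close> composed with \<open>- y (e\<^sup>t - 1)\<close>, whose constant term is \<open>0\<close>.
\<close>

definition geom_poly_egf :: "real \<Rightarrow> complex \<Rightarrow> complex fps" where
  "geom_poly_egf r y =
     fps_binomial (- of_real r) oo (- (fps_const y * (fps_exp 1 - 1)))"

definition geom_poly :: "nat \<Rightarrow> real \<Rightarrow> complex \<Rightarrow> complex" where
  "geom_poly n r y = fact n * fps_nth (geom_poly_egf r y) n"

lemma fps_exp_minus_1_power_nth: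
  "fps_nth ((fps_exp 1 - 1) ^ k :: complex fps) n = fact k * of_nat (Stirling n k) / fact n"
proof (induction n arbitrary: k)
  case 0
  show ?case by (cases k) (auto simp: fps_nth_power_0)
next
  case (Suc n)
  show ?case
  proof (cases k)
    case 0
    then show ?thesis by simp
  next
    case [simp]: (Suc j)
    define e :: "complex fps" where "e = fps_exp 1 - 1"
    have "fps_deriv e = e + 1" by (simp add: e_def)
    then have "fps_deriv (e ^ Suc j) = fps_const (of_nat (Suc j)) * (e ^ Suc j + e ^ j)"
      unfolding fps_deriv_power[of e "Suc j"] diff_Suc_1
      by (simp only: power_Suc distrib_right distrib_left mult_1_left mult.assoc)
    then have "fps_nth (fps_deriv (e ^ Suc j)) n =
        of_nat (Suc j) * (fps_nth (e ^ Suc j) n + fps_nth (e ^ j) n)"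
      by (simp only: fps_mult_left_const_nth fps_add_nth)
    also have "\<dots> = of_nat (Suc j) * (fact (Suc j) * of_nat (Stirling n (Suc j)) / fact n
        + fact j * of_nat (Stirling n j) / fact n)"
      by (simp only: Suc.IH e_def)
    also have "\<dots> = fact (Suc j) * of_nat (Stirling (Suc n) (Suc j)) / fact n"
      by (simp add: field_simps)
    finally have "of_nat (Suc n) * fps_nth (e ^ Suc j) (Suc n) =
        fact (Suc j) * of_nat (Stirling (Suc n) (Suc j)) / fact n"
      by (simp only: fps_deriv_nth Suc_eq_plus1)
    then have "fps_nth (e ^ Suc j) (Suc n) =
        fact (Suc j) * of_nat (Stirling (Suc n) (Suc j)) / fact n / of_nat (Suc n)"
      by (metis nonzero_mult_div_cancel_left of_nat_neq_0)
    then show ?thesis by (simp add: e_def mult.commute)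
  qed
qed

lemma geom_poly_eq_sum_Stirling:
  "geom_poly n r y =
     (\<Sum>k=0..n. of_nat (Stirling n k) * pochhammer (of_real r) k * y ^ k)"
proof -
  have "fact n * ((- of_real r gchoose k) * fps_nth ((- (fps_const y * (fps_exp 1 - 1))) ^ k) n)
      = of_nat (Stirling n k) * pochhammer (of_real r) k * y ^ k" for k
  proof -
    have "(- (fps_const y * (fps_exp 1 - 1))) ^ k =
        fps_const ((- y) ^ k) * (fps_exp 1 - 1 :: complex fps) ^ k"
      by (metis fps_const_neg fps_const_power mult_minus_left power_mult_distrib)
    moreover have "(- 1) ^ k * (- y) ^ k = y ^ k"
      by (metis minus_mult_minus mult_1 power_mult_distrib)
    ultimately show ?thesis
      by (simp add: fps_exp_minus_1_power_nth gbinomial_pochhammer mult.commute mult.left_commute)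
  qed
  then show ?thesis
    by (simp add: geom_poly_def geom_poly_egf_def fps_compose_nth sum_distrib_left)
qed

end

theory Submission
  imports Defs
begin

text \<open>
  Write \<open>G\<^sub>r\<close> for the generating function and \<open>s = r1 + r2 - 1\<close>. The left-hand side is a
  coefficient of \<open>G\<^sub>r\<^sub>1 G\<^sub>r\<^sub>2 = G\<^sub>s\<^sub>+\<^sub>1\<close>. Differentiation gives \<open>G\<^sub>s' = s y e\<^sup>t G\<^sub>s\<^sub>+\<^sub>1\<close>, while
  \<open>G\<^sub>s = (1 + y - y e\<^sup>t) G\<^sub>s\<^sub>+\<^sub>1\<close>, so that \<open>G\<^sub>s' + s G\<^sub>s = s (1 + y) G\<^sub>s\<^sub>+\<^sub>1\<close>.
\<close>

lemma geom_poly_egf_add: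
  "geom_poly_egf (r + s) y = geom_poly_egf r y * geom_poly_egf s y"
  using fps_binomial_add_mult[of "- complex_of_real r" "- of_real s"]
  by (simp add: geom_poly_egf_def flip: fps_compose_mult_distrib)

lemma geom_poly_egf_minus_1:
  "geom_poly_egf (- 1) y = 1 - fps_const y * (fps_exp 1 - 1)"
  by (simp add: geom_poly_egf_def fps_binomial_1 fps_compose_add_distrib)

lemma geom_poly_egf_eq_mult_Suc:
  "geom_poly_egf s y = (1 - fps_const y * (fps_exp 1 - 1)) * geom_poly_egf (s + 1) y"
  using geom_poly_egf_add[of "- 1" "s + 1" y] by (simp add: geom_poly_egf_minus_1)

text \<open>Coefficientwise this is the absorption identity
  \<open>(k + 1) * (c gchoose (k + 1)) = c * (c - 1 gchoose k)\<close>.\<close>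

lemma fps_deriv_binomial:
  "fps_deriv (fps_binomial c) = fps_const c * fps_binomial (c - 1 :: 'a :: field_char_0)"
  by (rule fps_ext) (use gbinomial_absorption in \<open>simp add: algebra_simps\<close>)

text \<open>Chain rule: the exponent \<open>- s\<close> drops to \<open>- (s + 1)\<close>, and its
  sign cancels that of the inner series.\<close>

lemma fps_deriv_geom_poly_egf:
  "fps_deriv (geom_poly_egf s y) =
     fps_const (of_real s * y) * fps_exp 1 * geom_poly_egf (s + 1) y"
  by (simp add: geom_poly_egf_def fps_compose_deriv fps_deriv_binomial fps_compose_mult_distrib
      fps_compose_uminus mult_ac flip: fps_const_mult fps_const_neg)

lemma fps_deriv_geom_poly_egf_add:
  "fps_deriv (geom_poly_egf s y) + fps_const (of_real s) * geom_poly_egf s y =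
     fps_const (of_real s * (1 + y)) * geom_poly_egf (s + 1) y"
  unfolding fps_deriv_geom_poly_egf
  \<comment> \<open>Occurrence 2 is the series at \<open>s\<close>; the other two are already at
    \<open>s + 1\<close>. Then the terms with \<open>fps_exp 1\<close> cancel.\<close>
  by (subst (2) geom_poly_egf_eq_mult_Suc)
    (simp add: algebra_simps flip: fps_const_mult fps_const_add)

lemma geom_poly_Suc_add:
  "geom_poly (Suc n) s y + of_real s * geom_poly n s y =
     of_real s * (1 + y) * geom_poly n (s + 1) y"
  \<comment> \<open>The derivative contributes a factor n + 1, which turns n! into (n + 1)!.\<close>
  using arg_cong[OF fps_deriv_geom_poly_egf_add, of "\<lambda>f. fact n * fps_nth f n" s y]
  by (simp add: geom_poly_def algebra_simps)

lemma geom_poly_add: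
  "geom_poly n (r + s) y =
     (\<Sum>k=0..n. of_nat (n choose k) * geom_poly k r y * geom_poly (n - k) s y)"
  by (auto simp: geom_poly_def geom_poly_egf_add fps_mult_nth sum_distrib_left binomial_fact
      intro!: sum.cong)

theorem theorem3p2:
  fixes r1 r2 :: real and n :: nat and y :: complex
  assumes "r1 > 0" and "r2 > 0" and "r1 + r2 \<noteq> 1" and "y \<noteq> -1"
  shows "(\<Sum>k=0..n. of_nat (n choose k) * geom_poly k r1 y * geom_poly (n - k) r2 y) =
    (geom_poly (n + 1) (r1 + r2 - 1) y + of_real (r1 + r2 - 1) * geom_poly n (r1 + r2 - 1) y)
      / (of_real (r1 + r2 - 1) * (1 + y))"
proof -
  have "complex_of_real (r1 + r2 - 1) \<noteq> 0"
    using assms(3) by (simp only: of_real_eq_0_iff)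
  moreover have "1 + y \<noteq> 0"
    using assms(4) by (simp add: add_eq_0_iff)
  ultimately show ?thesis
    using geom_poly_Suc_add[of n "r1 + r2 - 1" y] geom_poly_add[of n r1 r2 y] by simp
qed

end
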